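(* Let $b\colon\mathbb{N}\to\mathbb{C}$ be an $s$-function, and let $c\colon\mathbb{N}\to\mathbb{C}$ be a bounded arithmetic function of invariant average $A$ under multiplications. Then $$\lim_{N\to\infty}\frac1N\sum_{1\le n\le N} b(n)c(n)=\alpha\cdot A,$$ where $$\alpha=\lim_{N\to\infty}\frac1N\sum_{1\le n\le N} b(n)=\frac{6}{\pi^2}\sum_{f\in\mathscr{F}}\frac{b(f)}{f}\prod_{p\mid f}\Big(1+\frac1p\Big)^{-1}$$ (the product being over primes $p$ dividing $f$).
   Context: $\mathbb{N}=\{1,2,3,\dots\}$. $\mathscr{S}$ is the set of squarefree positive integers and $\mathscr{F}$ is the set of squarefull positive integers ($n$ is squarefull if $p^2\mid n$ for every prime $p\mid n$); $1\in\mathscr{S}$ and $1\in\mathscr{F}$. Every $n\ge1$ is uniquely $n=qf$ with $q\in\mathscr{S}$, $f\in\mathscr{F}$, $\gcd(q,f)=1$; $f=f(n)$ is called the squarefull part of $n$. A function $b\colon\mathbb{N}\to\mathbb{C}$ is an $s$-function (function with squarefull kernel) if $b(n)=b(f(n))$ for all $n\ge1$ and, for every $\varepsilon>0$, there is a constant $C_\varepsilon$ with $|b(n)|\le C_\varepsilon n^{\varepsilon}$ for all $n\ge1$. A bounded function $c\colon\mathbb{N}\to\mathbb{C}$ is of invariant average $A$ under multiplications if $\lim_{N\to\infty}\frac1N\sum_{n=1}^N c(n)$ exists and equals $A$, and for every $d\in\mathbb{N}$ the limit $\lim_{N\to\infty}\frac1N\sum_{n=1}^N c(dn)$ exists and equals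 $A$. *)

theory Defs
  imports "HOL-Analysis.Analysis" "HOL-Computational_Algebra.Squarefree"
begin

text \<open>Arithmetic functions on the positive integers are functions on \<^typ>\<open>nat\<close> whose value at
  \<open>0\<close> is never used.\<close>

definition squarefull :: "nat \<Rightarrow> bool" where
  "squarefull n \<longleftrightarrow> n > 0 \<and> (\<forall>p. prime p \<and> p dvd n \<longrightarrow> p\<^sup>2 dvd n)"

definition squarefull_part :: "nat \<Rightarrow> nat" where
  "squarefull_part n =
     (THE f. squarefull f \<and> (\<exists>q. squarefree q \<and> coprime q f \<and> n = q * f))"

definition s_function :: "(nat \<Rightarrow> complex) \<Rightarrow> bool" where
  "s_function b \<longleftrightarrow>
     (\<forall>n\<ge>1. b n = b (squarefull_part n)) \<and>
     (\<forall>\<epsilon>>0. \<exists>C::real. \<forall>n\<ge>1. norm (b n) \<le> C * real n powr \<epsilon>)"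

definition invariant_average :: "(nat \<Rightarrow> complex) \<Rightarrow> complex \<Rightarrow> bool" where
  "invariant_average c A \<longleftrightarrow>
     (\<lambda>N. (\<Sum>n=1..N. c n) / of_nat N) \<longlonglongrightarrow> A \<and>
     (\<forall>d\<ge>1. (\<lambda>N. (\<Sum>n=1..N. c (d * n)) / of_nat N) \<longlonglongrightarrow> A)"

text \<open>The decomposition behind \<^const>\<open>squarefull_part\<close> exists and is unique, so the definite
  description is well defined on positive integers.\<close>

lemma squarefull_decomp_exists:
  assumes "n > (0::nat)"
  shows "\<exists>f q. squarefull f \<and> squarefree q \<and> coprime q f \<and> n = q * f"
proof -
  define P where "P = {p \<in> prime_factors n. multiplicity p n = 1}"
  define R where "R = {p \<in> prime_factors n. multiplicity p n \<noteq> 1}"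
  define q where "q = (\<Prod>p\<in>P. p)"
  define f where "f = (\<Prod>p\<in>R. p ^ multiplicity p n)"
  have fin: "finite P" "finite R" and PR: "prime_factors n = P \<union> R" "P \<inter> R = {}"
    by (auto simp: P_def R_def)
  have primes: "prime p" if "p \<in> P \<union> R" for p
    using that PR(1) by (metis in_prime_factors_imp_prime)
  have "n = (\<Prod>p\<in>prime_factors n. p ^ multiplicity p n)"
    using assms by (simp add: prime_factorization_nat)
  also have "\<dots> = (\<Prod>p\<in>P. p ^ multiplicity p n) * f"
    unfolding PR(1) f_def using fin PR(2) by (simp add: prod.union_disjoint)
  also have "(\<Prod>p\<in>P. p ^ multiplicity p n) = q"
    unfolding q_def by (intro prod.cong) (auto simp: P_def)
  finally have n: "n = q * f" .
  have cop: "coprime q f"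
    unfolding q_def f_def using primes PR(2)
    by (intro prod_coprime_left prod_coprime_right) (auto intro!: primes_coprime)
  have sq: "squarefree q"
    unfolding q_def using primes
    by (intro squarefree_prod_coprime) (auto intro!: primes_coprime squarefree_prime)
  have "p\<^sup>2 dvd f" if p: "prime p" "p dvd f" for p
  proof -
    obtain r where r: "r \<in> R" "p dvd r ^ multiplicity r n"
      using p fin(2) unfolding f_def by (auto simp: prime_dvd_prod_iff)
    hence "p dvd r" using p(1) by (auto dest: prime_dvd_power)
    with p(1) primes r(1) have [simp]: "p = r" by (simp add: primes_dvd_imp_eq)
    have "multiplicity r n \<ge> 2"
      using r(1) unfolding R_def by (auto simp: prime_factors_multiplicity)
    hence "r\<^sup>2 dvd r ^ multiplicity r n" by (rule le_imp_power_dvd)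
    also have "\<dots> dvd f" unfolding f_def using fin(2) r(1) by (rule dvd_prodI)
    finally show ?thesis by simp
  qed
  moreover have "f > 0" using n assms by (cases "f = 0") auto
  ultimately have "squarefull f" by (auto simp: squarefull_def)
  with sq cop n show ?thesis by blast
qed

lemma squarefull_decomp_dvd:
  assumes "squarefull f" "squarefree q" "coprime q f"
    and "squarefull f'" "squarefree q'" "coprime q' f'"
    and eq: "q * f = q' * f'"
  shows "f dvd (f' :: nat)"
proof -
  have "coprime f q'"
  proof (rule ccontr)
    assume "\<not> coprime f q'"
    then obtain p where p: "prime p" "p dvd f" "p dvd q'"
      by (metis coprime_def gcd_greatest_iff is_unit_gcd prime_factor_nat nat_dvd_1_iff_1)
    have "\<not> p dvd f'"
      using p assms(6) by (metis coprime_common_divisor not_prime_unit)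
    hence "coprime (p\<^sup>2) f'" using p(1) by (simp add: prime_imp_coprime)
    moreover have "p\<^sup>2 dvd q' * f'"
      using p assms(1) eq by (metis squarefull_def dvd_mult)
    ultimately have "p\<^sup>2 dvd q'" by (simp add: coprime_dvd_mult_left_iff)
    with assms(5) p(1) show False by (auto simp: squarefree_def)
  qed
  moreover have "f dvd q' * f'" using eq by (metis dvd_triv_right)
  ultimately show ?thesis by (simp add: coprime_dvd_mult_right_iff)
qed

lemma squarefull_part_ex1:
  assumes "n > (0::nat)"
  shows "\<exists>!f. squarefull f \<and> (\<exists>q. squarefree q \<and> coprime q f \<and> n = q * f)"
  using squarefull_decomp_exists[OF assms]
  by (auto intro!: dvd_antisym intro: squarefull_decomp_dvd)

end

(* Writing n = f q with f squarefull, q squarefree and coprime to f, the sum of b(n) c(n) splits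
   into the sums of c(f q) over q, weighted by b(f). For fixed f the condition on q is a sieve by
   the coprime moduli p (for p dividing f) and p^2 (for the other primes). Sieving by finitely many
   coprime moduli m multiplies the average of an invariant c by the product of the 1 - 1/m, and the
   primes beyond P affect a proportion of at most 1/P of the integers. The resulting infinite
   product is evaluated by applying the same sieve to the series of the 1/n^2. Since a squarefull
   number has the form x^2 y^3, the sum of |b(f)|/f over squarefull f converges, so dominated
   convergence allows the limit to be taken for each f separately. *)

theory Submission
  imports Defs
begin

section \<open>Averages of an invariant function over sieved integers\<close>

text \<open>The quotient is \<open>s (N div m) / (N div m)\<close> times
  \<open>(N div m) / N\<close>: the first factor is the given sequence along an index tending to
  infinity, the second tends to \<open>1 / m\<close>. This is how the multiples of \<open>m\<close>
  enter an average.\<close>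

lemma tendsto_average_div:
  fixes s :: "nat \<Rightarrow> complex"
  assumes "(\<lambda>N. s N / of_nat N) \<longlonglongrightarrow> L" "m > 0"
  shows "(\<lambda>N. s (N div m) / of_nat N) \<longlonglongrightarrow> L / of_nat m"
proof -
  have top: "filterlim (\<lambda>N. N div m) at_top sequentially"
    unfolding filterlim_at_top
  proof
    fix Z
    show "\<forall>\<^sub>F N in sequentially. Z \<le> N div m"
      using eventually_ge_at_top[of "Z * m"]
      by eventually_elim (use \<open>m > 0\<close> in \<open>simp add: less_eq_div_iff_mult_less_eq\<close>)
  qed
  have "(\<lambda>N. real (N div m) / real N) \<longlonglongrightarrow> 1 / real m"
  proof (rule tendsto_sandwich)
    show "(\<lambda>N. 1 / real m - 1 / real N) \<longlonglongrightarrow> 1 / real m"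
      by (rule tendsto_eq_intros lim_1_over_n | simp)+
    show "(\<lambda>N. 1 / real m) \<longlonglongrightarrow> 1 / real m" by simp
    have *: "real N / real m - 1 \<le> real (N div m)" "real (N div m) \<le> real N / real m" for N
    proof -
      have "real N = real m * real (N div m) + real (N mod m)"
        by (metis mult_div_mod_eq of_nat_add of_nat_mult)
      moreover have "real (N mod m) < real m" using \<open>m > 0\<close> by simp
      ultimately show "real N / real m - 1 \<le> real (N div m)" "real (N div m) \<le> real N / real m"
        using \<open>m > 0\<close> by (auto simp: field_simps)
    qed
    show "\<forall>\<^sub>F N in sequentially. real (N div m) / real N \<le> 1 / real m"
      using eventually_gt_at_top[of 0]
    proof eventually_elim
      case (elim N)
      show ?case using *(2)[of N] elim \<open>m > 0\<close> by (simp add: field_simps)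
    qed
    show "\<forall>\<^sub>F N in sequentially. 1 / real m - 1 / real N \<le> real (N div m) / real N"
      using eventually_gt_at_top[of 0]
    proof eventually_elim
      case (elim N)
      have "(real N / real m - 1) / real N \<le> real (N div m) / real N"
        using *(1)[of N] by (intro divide_right_mono) auto
      thus ?case using elim by (simp add: diff_divide_distrib)
    qed
  qed
  hence "(\<lambda>N. of_real (real (N div m) / real N) :: complex) \<longlonglongrightarrow> of_real (1 / real m)"
    by (rule tendsto_of_real)
  from tendsto_mult[OF filterlim_compose[OF assms(1) top] this]
  have "(\<lambda>N. s (N div m) / of_nat (N div m) * (of_nat (N div m) / of_nat N)) \<longlonglongrightarrow> L / of_nat m"
    by simp
  moreover have "\<forall>\<^sub>F N in sequentially.
      s (N div m) / of_nat (N div m) * (of_nat (N div m) / of_nat N) = s (N div m) / of_nat N"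
    \<comment> \<open>Cancelling \<open>N div m\<close> requires it to be nonzero, which holds from
      \<open>N = m\<close> on.\<close>
    using eventually_ge_at_top[of m]
    by eventually_elim (use \<open>m > 0\<close> in \<open>simp add: div_eq_0_iff\<close>)
  ultimately show ?thesis by (rule Lim_transform_eventually)
qed

text \<open>A surviving integer divisible by \<open>m i\<close> is \<open>m i * k\<close>, and by
  coprimality \<open>k\<close> survives the sieve by \<open>S\<close> exactly when
  \<open>m i * k\<close> does. One more modulus therefore removes a rescaled copy of a shorter
  sieved set.\<close>

lemma sieve_insert:
  fixes m :: "'i \<Rightarrow> nat"
  assumes "\<And>j. j \<in> S \<Longrightarrow> coprime (m i) (m j)" "m i > 0"
  shows "{n\<in>{1..N}. \<forall>j\<in>S. \<not> m j dvd n} =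
     {n\<in>{1..N}. \<forall>j\<in>insert i S. \<not> m j dvd n} \<union>
     (*) (m i) ` {k\<in>{1..N div m i}. \<forall>j\<in>S. \<not> m j dvd k}" (is "?L = ?A \<union> ?B")
proof -
  have *: "m j dvd m i * k \<longleftrightarrow> m j dvd k" if "j \<in> S" for j k
    using assms(1)[OF that] by (simp add: coprime_commute coprime_dvd_mult_right_iff)
  show ?thesis
  proof (intro equalityI subsetI)
    fix n assume n: "n \<in> ?L"
    show "n \<in> ?A \<union> ?B"
    proof (cases "m i dvd n")
      case True
      then obtain k where k: "n = m i * k" by blast
      have "k \<in> {k\<in>{1..N div m i}. \<forall>j\<in>S. \<not> m j dvd k}"
        using n k * assms(2) by (auto simp: less_eq_div_iff_mult_less_eq mult.commute Suc_le_eq)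
      thus ?thesis using k by blast
    qed (use n in auto)
  next
    fix n assume "n \<in> ?A \<union> ?B"
    thus "n \<in> ?L"
      using assms(2) * by (auto simp: less_eq_div_iff_mult_less_eq mult.commute Suc_le_eq)
  qed
qed

text \<open>Induction on \<open>S\<close>. A new modulus \<open>m i\<close> subtracts the sieved sum
  of \<open>c (d * m i * k)\<close> over \<open>k\<close> up to \<open>N div m i\<close>; by
  invariance its average has the same limit apart from a factor \<open>1 / m i\<close>. The dilation
  \<open>d\<close> is kept general because the induction passes from \<open>d\<close> to
  \<open>d * m i\<close>.\<close>

lemma average_sieve:
  fixes m :: "'i \<Rightarrow> nat"
  assumes "finite S" "pairwise (\<lambda>i j. coprime (m i) (m j)) S" "\<And>i. i \<in> S \<Longrightarrow> m i > 0"
    and "invariant_average c A" "d \<ge> 1"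
  shows "(\<lambda>N. (\<Sum>n | n \<in> {1..N} \<and> (\<forall>i\<in>S. \<not> m i dvd n). c (d * n)) / of_nat N)
           \<longlonglongrightarrow> A * (\<Prod>i\<in>S. 1 - 1 / of_nat (m i))"
  using assms(1-3,5)
proof (induction S arbitrary: d rule: finite_induct)
  case empty
  moreover have "{n. n \<in> {1..N} \<and> (\<forall>i\<in>{}. \<not> m i dvd n)} = {1..N}" for N by auto
  ultimately show ?case using assms(4) by (simp add: invariant_average_def)
next
  case (insert i S)
  have cop: "coprime (m i) (m j)" if "j \<in> S" for j
    using insert.prems(1) insert.hyps that by (auto simp: pairwise_insert)
  have IH: "(\<lambda>N. (\<Sum>n | n \<in> {1..N} \<and> (\<forall>i\<in>S. \<not> m i dvd n). c (e * n)) / of_nat N)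
           \<longlonglongrightarrow> A * (\<Prod>i\<in>S. 1 - 1 / of_nat (m i))" if "e \<ge> 1" for e
    using insert.IH insert.prems that by (auto simp: pairwise_insert)
  have mi: "m i > 0" using insert.prems by auto
  have eq: "(\<Sum>n | n \<in> {1..N} \<and> (\<forall>j\<in>insert i S. \<not> m j dvd n). c (d * n)) =
      (\<Sum>n | n \<in> {1..N} \<and> (\<forall>j\<in>S. \<not> m j dvd n). c (d * n)) -
      (\<Sum>k | k \<in> {1..N div m i} \<and> (\<forall>j\<in>S. \<not> m j dvd k). c ((d * m i) * k))" for N
  proof -
    have "(\<Sum>n | n \<in> {1..N} \<and> (\<forall>j\<in>S. \<not> m j dvd n). c (d * n)) =
      (\<Sum>n | n \<in> {1..N} \<and> (\<forall>j\<in>insert i S. \<not> m j dvd n). c (d * n)) +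
      (\<Sum>n \<in> (*) (m i) ` {k\<in>{1..N div m i}. \<forall>j\<in>S. \<not> m j dvd k}. c (d * n))"
      by (subst sum.union_disjoint[symmetric])
         (auto intro!: arg_cong[of _ _ "sum _"] simp: sieve_insert[of S m i N, OF cop mi, simplified])
    also have "(\<Sum>n \<in> (*) (m i) ` {k\<in>{1..N div m i}. \<forall>j\<in>S. \<not> m j dvd k}. c (d * n)) =
       (\<Sum>k | k \<in> {1..N div m i} \<and> (\<forall>j\<in>S. \<not> m j dvd k). c ((d * m i) * k))"
      by (subst sum.reindex) (use mi in \<open>auto simp: inj_on_def mult.assoc\<close>)
    finally show ?thesis by simp
  qed
  have "(\<lambda>N. (\<Sum>n | n \<in> {1..N} \<and> (\<forall>j\<in>insert i S. \<not> m j dvd n). c (d * n)) / of_nat N) \<longlonglongrightarrow>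
     A * (\<Prod>i\<in>S. 1 - 1 / of_nat (m i)) - A * (\<Prod>i\<in>S. 1 - 1 / of_nat (m i)) / of_nat (m i)"
    unfolding eq diff_divide_distrib
    by (intro tendsto_diff IH tendsto_average_div[OF IH]) (use mi insert.prems in \<open>auto simp: Suc_le_eq\<close>)
  also have "A * (\<Prod>i\<in>S. 1 - 1 / of_nat (m i)) - A * (\<Prod>i\<in>S. 1 - 1 / of_nat (m i)) / of_nat (m i)
     = A * (\<Prod>i\<in>insert i S. 1 - 1 / of_nat (m i))"
    using insert.hyps by (simp add: algebra_simps diff_divide_distrib)
  finally show ?case .
qed

section \<open>The product of 1 - 1/p^2 over the primes\<close>

text \<open>The same induction, applied to the convergent series of 1/n^2 with sum pi^2/6: the
  multiples of \<open>m i\<close> in a sieved set contribute \<open>1 / (m i)^2\<close> times the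
  whole.\<close>

lemma sum_inverse_squares_sieve:
  fixes m :: "'i \<Rightarrow> nat"
  assumes "finite S" "pairwise (\<lambda>i j. coprime (m i) (m j)) S" "\<And>i. i \<in> S \<Longrightarrow> m i > 0"
  shows "((\<lambda>n. 1 / (real n)\<^sup>2) has_sum (pi\<^sup>2 / 6 * (\<Prod>i\<in>S. 1 - 1 / (real (m i))\<^sup>2)))
           {n. n \<ge> 1 \<and> (\<forall>i\<in>S. \<not> m i dvd n)}"
  using assms
proof (induction S rule: finite_induct)
  case empty
  have "((\<lambda>n. 1 / (real n + 1)\<^sup>2) has_sum (pi\<^sup>2 / 6)) UNIV"
    using inverse_squares_sums by (intro sums_nonneg_imp_has_sum) (auto simp: add_ac)
  hence "((\<lambda>n. 1 / (real n)\<^sup>2) \<circ> Suc has_sum (pi\<^sup>2 / 6)) UNIV" by (simp add: o_def add_ac)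
  hence "((\<lambda>n. 1 / (real n)\<^sup>2) has_sum (pi\<^sup>2 / 6)) (range Suc)"
    by (subst has_sum_reindex) auto
  also have "range Suc = {n. n \<ge> 1}" by (auto simp: image_iff Suc_le_eq gr0_conv_Suc)
  finally show ?case by simp
next
  case (insert i S)
  define T where "T = {n. n \<ge> 1 \<and> (\<forall>i\<in>S. \<not> m i dvd n)}"
  define P where "P = pi\<^sup>2 / 6 * (\<Prod>i\<in>S. 1 - 1 / (real (m i))\<^sup>2)"
  have IH: "((\<lambda>n. 1 / (real n)\<^sup>2) has_sum P) T"
    unfolding T_def P_def using insert by (auto simp: pairwise_insert)
  have mi: "m i > 0" using insert.prems by auto
  have *: "m j dvd m i * k \<longleftrightarrow> m j dvd k" if "j \<in> S" for j k
    using insert.prems(1) insert.hyps that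
    by (auto simp: pairwise_insert coprime_commute coprime_dvd_mult_right_iff)
  have "((\<lambda>k. 1 / (real (m i))\<^sup>2 * (1 / (real k)\<^sup>2)) has_sum (1 / (real (m i))\<^sup>2 * P)) T"
    by (rule has_sum_cmult_right[OF IH])
  hence "((\<lambda>n. 1 / (real n)\<^sup>2) \<circ> (*) (m i) has_sum (1 / (real (m i))\<^sup>2 * P)) T"
    by (simp add: o_def power_mult_distrib)
  hence "((\<lambda>n. 1 / (real n)\<^sup>2) has_sum (1 / (real (m i))\<^sup>2 * P)) ((*) (m i) ` T)"
    by (subst has_sum_reindex) (use mi in \<open>auto simp: inj_on_def\<close>)
  \<comment> \<open>The rescaled copy lies inside \<open>T\<close> because multiplication by
    \<open>m i\<close> creates no divisibility by the other moduli.\<close>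
  from has_sum_Diff[OF IH this]
  have "((\<lambda>n. 1 / (real n)\<^sup>2) has_sum (P - 1 / (real (m i))\<^sup>2 * P)) (T - (*) (m i) ` T)"
    using mi * by (force simp: T_def)
  also have "T - (*) (m i) ` T = {n. n \<ge> 1 \<and> (\<forall>j\<in>insert i S. \<not> m j dvd n)}"
  proof (intro equalityI subsetI)
    fix n assume n: "n \<in> T - (*) (m i) ` T"
    have "\<not> m i dvd n"
    proof
      assume "m i dvd n"
      then obtain k where k: "n = m i * k" by blast
      hence "k \<in> T" using n * by (auto simp: T_def Suc_le_eq)
      thus False using n k by blast
    qed
    thus "n \<in> {n. n \<ge> 1 \<and> (\<forall>j\<in>insert i S. \<not> m j dvd n)}"
      using n by (simp add: T_def)
  next
    fix n assume "n \<in> {n. n \<ge> 1 \<and> (\<forall>j\<in>insert i S. \<not> m j dvd n)}"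
    thus "n \<in> T - (*) (m i) ` T" by (auto simp: T_def)
  qed
  also have "P - 1 / (real (m i))\<^sup>2 * P = pi\<^sup>2 / 6 * (\<Prod>j\<in>insert i S. 1 - 1 / (real (m j))\<^sup>2)"
    using insert.hyps by (simp add: P_def algebra_simps)
  finally show ?case .
qed

text \<open>Sieving by the primes up to \<open>P\<close> leaves 1 and otherwise only integers beyond
  \<open>P\<close>. Hence pi^2/6 times the partial product lies between 1 and 1 plus a tail of the
  series of 1/n^2, and it is squeezed to 1.\<close>

lemma prod_primes_inverse_squares:
  "(\<lambda>P. \<Prod>p | prime p \<and> p \<le> P. 1 - 1 / (real p)\<^sup>2) \<longlonglongrightarrow> 6 / pi\<^sup>2"
proof -
  define E where "E P = (\<Prod>p | prime p \<and> p \<le> P. 1 - 1 / (real p)\<^sup>2)" for P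
  define T where "T P = {n::nat. n \<ge> 1 \<and> (\<forall>p\<in>{p. prime p \<and> p \<le> P}. \<not> p dvd n)}" for P
  let ?g = "\<lambda>n. 1 / (real n)\<^sup>2"
  have sT: "(?g has_sum (pi\<^sup>2 / 6 * E P)) (T P)" for P
    unfolding T_def E_def
    by (rule sum_inverse_squares_sieve[where m = "\<lambda>p. p"])
       (auto intro!: primes_coprime simp: pairwise_def prime_gt_0_nat)
  have s1: "(?g has_sum (pi\<^sup>2 / 6)) {1..}"
    using sum_inverse_squares_sieve[of "{}" id] by (simp add: atLeast_def)
  have tail: "(?g has_sum (pi\<^sup>2 / 6 - (\<Sum>n=1..P. ?g n))) ({1..} - {1..P})" for P
    by (intro has_sum_Diff[OF s1 has_sum_finite]) auto
  have lower: "1 \<le> pi\<^sup>2 / 6 * E P" for P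
  proof -
    have "(?g has_sum 1) {1}" using has_sum_finite[of "{1}" ?g] by simp
    thus ?thesis
      by (rule has_sum_mono2[OF _ sT[of P]]) (auto simp: T_def not_le prime_gt_1_nat)
  qed
  have upper: "pi\<^sup>2 / 6 * E P \<le> 1 + (pi\<^sup>2 / 6 - (\<Sum>n=1..P. ?g n))" for P
  proof -
    \<comment> \<open>The index 0 contributes nothing, since division by zero gives 0. The
      assumption \<open>P \<ge> 1\<close> keeps the two sets disjoint; \<open>P = 0\<close> is
      handled below through the empty product.\<close>
    have "(?g has_sum (1 + (pi\<^sup>2 / 6 - (\<Sum>n=1..P. ?g n)))) ({0,1} \<union> ({1..} - {1..P}))" if "P \<ge> 1"
      using has_sum_finite[of "{0,1}" ?g] that by (intro has_sum_Un_disjoint tail) auto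
    moreover have "T P \<subseteq> {0,1} \<union> ({1..} - {1..P})"
    proof
      fix n assume n: "n \<in> T P"
      show "n \<in> {0,1} \<union> ({1..} - {1..P})"
      proof (cases "n = 1")
        case False
        \<comment> \<open>No prime up to \<open>P\<close> divides \<open>n\<close>, so a prime
          factor of \<open>n\<close> exceeds \<open>P\<close>, and so does \<open>n\<close>.\<close>
        then obtain p where "prime p" "p dvd n" using prime_factor_nat by blast
        moreover have "p \<le> n" using n \<open>p dvd n\<close> by (auto simp: T_def dvd_imp_le)
        ultimately show ?thesis using n by (force simp: T_def)
      qed auto
    qed
    ultimately have "pi\<^sup>2 / 6 * E P \<le> 1 + (pi\<^sup>2 / 6 - (\<Sum>n=1..P. ?g n))" if "P \<ge> 1"
      by (rule has_sum_mono2[OF sT]) (use that in auto)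
    moreover have "E 0 = 1" unfolding E_def by (rule prod.neutral) auto
    ultimately show ?thesis by (cases "P = 0") auto
  qed
  have "(\<lambda>P. \<Sum>n<P. 1 / (real n + 1)\<^sup>2) \<longlonglongrightarrow> pi\<^sup>2 / 6"
    using inverse_squares_sums by (simp add: sums_def add_ac)
  also have "(\<lambda>P. \<Sum>n<P. 1 / (real n + 1)\<^sup>2) = (\<lambda>P. \<Sum>n=1..P. ?g n)"
    by (intro ext sum.reindex_bij_witness[of _ "\<lambda>n. n - 1" Suc]) (auto simp: add_ac)
  finally have "(\<lambda>P. 1 + (pi\<^sup>2 / 6 - (\<Sum>n=1..P. ?g n))) \<longlonglongrightarrow> 1 + (pi\<^sup>2 / 6 - pi\<^sup>2 / 6)"
    by (intro tendsto_intros)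
  hence "(\<lambda>P. pi\<^sup>2 / 6 * E P) \<longlonglongrightarrow> 1"
    using lower upper by (intro real_tendsto_sandwich[of "\<lambda>_. 1" "\<lambda>P. pi\<^sup>2 / 6 * E P"]) auto
  from tendsto_mult[OF tendsto_const[of "6 / pi\<^sup>2"] this] show ?thesis
    unfolding E_def by simp
qed

section \<open>Integers with a large square divisor\<close>

text \<open>Telescoping with 1/(n+1)^2 \<le> 1/n - 1/(n+1). The induction carries the sharper bound
  \<open>1 / P - 1 / N\<close>, valid for \<open>P \<le> N\<close>; otherwise the sum is
  empty.\<close>

lemma sum_inverse_squares_tail:
  assumes "P \<ge> 1"
  shows "(\<Sum>m\<in>{P<..N}. 1 / (real m)\<^sup>2) \<le> 1 / real P"
proof (cases "P \<le> N")
  case True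
  hence "(\<Sum>m\<in>{P<..N}. 1 / (real m)\<^sup>2) \<le> 1 / real P - 1 / real N"
  proof (induction N rule: dec_induct)
    case (step n)
    have "{P<..Suc n} = insert (Suc n) {P<..n}" using step.hyps by auto
    moreover have "1 / (real (Suc n))\<^sup>2 \<le> 1 / real n - 1 / real (Suc n)"
    proof -
      have "1 / (real (Suc n))\<^sup>2 \<le> 1 / (real n * real (Suc n))"
        using step.hyps assms by (intro divide_left_mono) (auto simp: power2_eq_square)
      also have "\<dots> = 1 / real n - 1 / real (Suc n)"
        using step.hyps assms by (simp add: field_simps)
      finally show ?thesis .
    qed
    ultimately show ?case using step.IH by simp
  qed simp
  thus ?thesis using order_trans by fastforce
qed simp

text \<open>A union bound: at most N/m^2 integers up to \<open>N\<close> are multiples of m^2, and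
  these counts are summed over m > P.\<close>

lemma card_large_square_divisor:
  assumes "P \<ge> 1"
  shows "real (card {n\<in>{1..N}. \<exists>m>P. m\<^sup>2 dvd n}) \<le> real N / real P"
proof -
  have "{n\<in>{1..N}. \<exists>m>P. m\<^sup>2 dvd n} \<subseteq> (\<Union>m\<in>{P<..N}. (*) (m\<^sup>2) ` {1..N div m\<^sup>2})"
  proof
    fix n assume "n \<in> {n\<in>{1..N}. \<exists>m>P. m\<^sup>2 dvd n}"
    then obtain m k where mk: "n \<in> {1..N}" "m > P" "n = m\<^sup>2 * k" by auto
    \<comment> \<open>A square divisor of \<open>n\<close> forces \<open>m \<le> N\<close>, which
      makes the union finite.\<close>
    have "k \<ge> 1" using mk by (cases k) auto
    hence "m\<^sup>2 \<le> m\<^sup>2 * k" by simp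
    also have "\<dots> \<le> N" using mk(1,3) by simp
    finally have "m\<^sup>2 \<le> N" .
    moreover have "m \<le> m\<^sup>2" by (simp add: power2_nat_le_imp_le power2_eq_square)
    ultimately have "m \<in> {P<..N}" using mk by auto
    moreover have "k \<in> {1..N div m\<^sup>2}"
      using mk by (auto simp: less_eq_div_iff_mult_less_eq mult.commute Suc_le_eq)
    ultimately show "n \<in> (\<Union>m\<in>{P<..N}. (*) (m\<^sup>2) ` {1..N div m\<^sup>2})" using mk(3) by blast
  qed
  hence "card {n\<in>{1..N}. \<exists>m>P. m\<^sup>2 dvd n} \<le> card (\<Union>m\<in>{P<..N}. (*) (m\<^sup>2) ` {1..N div m\<^sup>2})"
    by (intro card_mono) auto
  also have "\<dots> \<le> (\<Sum>m\<in>{P<..N}. card ((*) (m\<^sup>2) ` {1..N div m\<^sup>2}))"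
    by (rule card_UN_le) auto
  also have "\<dots> \<le> (\<Sum>m\<in>{P<..N}. N div m\<^sup>2)"
  proof (rule sum_mono)
    show "card ((*) (m\<^sup>2) ` {1..N div m\<^sup>2}) \<le> N div m\<^sup>2" for m
      using card_image_le[of "{1..N div m\<^sup>2}" "(*) (m\<^sup>2)"] by simp
  qed
  finally have "real (card {n\<in>{1..N}. \<exists>m>P. m\<^sup>2 dvd n}) \<le> real (\<Sum>m\<in>{P<..N}. N div m\<^sup>2)"
    by (rule of_nat_mono)
  also have "\<dots> = (\<Sum>m\<in>{P<..N}. real (N div m\<^sup>2))" by (rule of_nat_sum)
  also have "\<dots> \<le> (\<Sum>m\<in>{P<..N}. real N * (1 / (real m)\<^sup>2))"
  proof (rule sum_mono)
    show "real (N div m\<^sup>2) \<le> real N * (1 / (real m)\<^sup>2)" for m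
      using of_nat_div_le_of_nat[of N "m\<^sup>2", where 'a = real] by simp
  qed
  also have "\<dots> \<le> real N * (1 / real P)"
    unfolding sum_distrib_left[symmetric]
    by (intro mult_left_mono sum_inverse_squares_tail assms) auto
  finally show ?thesis by simp
qed

section \<open>Averages over squarefree integers coprime to f\<close>

text \<open>Every admissible \<open>q\<close> passes the sieve: coprimality excludes the primes
  dividing \<open>f\<close>, squarefreeness the squares of the others.\<close>

lemma squarefree_coprime_not_dvd:
  fixes q f :: nat
  assumes "squarefree q" "coprime q f" "prime p"
  shows "\<not> (if p dvd f then p else p\<^sup>2) dvd q"
proof (cases "p dvd f")
  case True
  have "\<not> p dvd q"
    using coprime_common_divisor[of q f p] assms True not_prime_unit by blast
  thus ?thesis using True by simp
next
  case False
  have "\<not> p\<^sup>2 dvd q" using assms squarefreeD[of q p] not_prime_unit by blast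
  thus ?thesis using False by simp
qed

text \<open>Partial converse for the sieve truncated at \<open>P\<close>. Since
  \<open>f \<le> P\<close>, all prime factors of \<open>f\<close> are sieved, so \<open>q\<close>
  can fail only through the square of a prime beyond \<open>P\<close>.\<close>

lemma squarefree_coprime_sieve:
  fixes q f :: nat
  assumes "q > 0" "f > 0" "f \<le> P"
    and *: "\<And>p. prime p \<Longrightarrow> p \<le> P \<Longrightarrow> \<not> (if p dvd f then p else p\<^sup>2) dvd q"
  shows "squarefree q \<and> coprime q f \<or> (\<exists>m>P. m\<^sup>2 dvd q)"
proof (cases "squarefree q")
  case True
  have "coprime q f"
  proof (rule ccontr)
    assume "\<not> coprime q f"
    hence "gcd q f \<noteq> 1" by (simp add: coprime_iff_gcd_eq_1)
    then obtain p where p: "prime p" "p dvd gcd q f" using prime_factor_nat by blast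
    moreover have "p \<le> P" using dvd_imp_le[of p f] p assms by auto
    ultimately show False using *[of p] by auto
  qed
  thus ?thesis using True by simp
next
  case False
  then obtain p where p: "prime p" "p\<^sup>2 dvd q"
    using assms(1) by (auto simp: squarefree_factorial_semiring)
  hence "p dvd q" by (meson dvd_power dvd_trans zero_less_numeral)
  hence "\<not> p \<le> P" using p *[of p] by (auto split: if_splits)
  thus ?thesis using p by (intro disjI2 exI[of _ p]) auto
qed

text \<open>The truncated sieve average \<open>G P\<close> tends to \<open>L P\<close>, and it stays
  within \<open>B / P\<close> of the wanted average uniformly in \<open>N\<close>. Letting
  \<open>P\<close> grow interchanges the two limits.\<close>

lemma average_squarefree_coprime:
  assumes inv: "invariant_average c A" and B: "\<And>n. n \<ge> 1 \<Longrightarrow> norm (c n) \<le> B" and f: "f \<ge> 1"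
  shows "(\<lambda>N. (\<Sum>q | q \<in> {1..N} \<and> squarefree q \<and> coprime q f. c (f * q)) / of_nat N) \<longlonglongrightarrow>
    A * (6 / (of_real pi)\<^sup>2 * (\<Prod>p | prime p \<and> p dvd f. inverse (1 + 1 / of_nat p)))"
    (is "?F \<longlonglongrightarrow> ?L")
proof -
  define r where "r p = (if p dvd f then p else p\<^sup>2)" for p
  define Q where "Q P = {p. prime p \<and> p \<le> P}" for P :: nat
  define L where "L P = A * (\<Prod>p\<in>Q P. 1 - 1 / of_nat (r p))" for P
  define G where "G P N = (\<Sum>q | q \<in> {1..N} \<and> (\<forall>p\<in>Q P. \<not> r p dvd q). c (f * q)) / of_nat N" for P N
  have finQ: "finite (Q P)" for P by (rule finite_subset[of _ "{..P}"]) (auto simp: Q_def)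
  have G: "G P \<longlonglongrightarrow> L P" for P
    unfolding G_def L_def
  proof (rule average_sieve[OF finQ _ _ inv f])
    show "pairwise (\<lambda>i j. coprime (r i) (r j)) (Q P)"
      by (auto simp: pairwise_def Q_def r_def primes_coprime)
  qed (auto simp: Q_def r_def prime_gt_0_nat)
  have B0: "B \<ge> 0" using B[of 1] norm_ge_zero order_trans by blast
  \<comment> \<open>The two sums differ only over \<open>X - Y\<close>, whose elements have a square
    divisor m^2 with m > P, a proportion of at most 1/P.\<close>
  have FG: "norm (?F N - G P N) \<le> B / real P" if P: "P \<ge> f" for N P
  proof -
    define X where "X = {q. q \<in> {1..N} \<and> (\<forall>p\<in>Q P. \<not> r p dvd q)}"
    define Y where "Y = {q. q \<in> {1..N} \<and> squarefree q \<and> coprime q f}"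
    have "Y \<subseteq> X"
    proof
      fix q assume q: "q \<in> Y"
      have "\<not> r p dvd q" if "p \<in> Q P" for p
        unfolding r_def
        by (rule squarefree_coprime_not_dvd) (use q that in \<open>auto simp: Y_def Q_def\<close>)
      thus "q \<in> X" using q by (auto simp: X_def Y_def)
    qed
    have XY: "X - Y \<subseteq> {n\<in>{1..N}. \<exists>m>P. m\<^sup>2 dvd n}"
    proof
      fix q assume q: "q \<in> X - Y"
      have "squarefree q \<and> coprime q f \<or> (\<exists>m>P. m\<^sup>2 dvd q)"
        by (rule squarefree_coprime_sieve) (use q f P in \<open>auto simp: X_def Q_def r_def\<close>)
      thus "q \<in> {n\<in>{1..N}. \<exists>m>P. m\<^sup>2 dvd n}" using q by (auto simp: X_def Y_def)
    qed
    have "?F N - G P N = - (\<Sum>q\<in>X - Y. c (f * q)) / of_nat N"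
      unfolding G_def X_def[symmetric] Y_def[symmetric]
      by (subst sum_diff) (use \<open>Y \<subseteq> X\<close> in \<open>auto simp: X_def diff_divide_distrib\<close>)
    also have "norm \<dots> = norm (\<Sum>q\<in>X - Y. c (f * q)) / real N"
      by (simp add: norm_divide)
    also have "norm (\<Sum>q\<in>X - Y. c (f * q)) \<le> real (card (X - Y)) * B"
      by (rule sum_norm_bound) (use f in \<open>auto simp: X_def intro!: B\<close>)
    also have "real (card (X - Y)) \<le> real (card {n\<in>{1..N}. \<exists>m>P. m\<^sup>2 dvd n})"
      using XY by (intro of_nat_mono card_mono) auto
    also have "\<dots> \<le> real N / real P" using f P by (intro card_large_square_divisor) auto
    finally have "norm (?F N - G P N) \<le> real N / real P * B / real N"
      using B0 by (simp add: mult_right_mono divide_right_mono)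
    also have "\<dots> \<le> B / real P" using B0 by (cases "N = 0") auto
    finally show ?thesis .
  qed
  have "L \<longlonglongrightarrow> ?L"
  proof -
    have "\<forall>\<^sub>F P in sequentially.
      A * (of_real (\<Prod>p\<in>Q P. 1 - 1 / (real p)\<^sup>2) * (\<Prod>p | prime p \<and> p dvd f. inverse (1 + 1 / of_nat p))) = L P"
      \<comment> \<open>From \<open>P = f\<close> on, the primes up to \<open>P\<close> include
        every prime factor of \<open>f\<close>.\<close>
      using eventually_ge_at_top[of f]
    proof eventually_elim
      case (elim P)
      have "p \<le> P" if "p dvd f" for p
        using dvd_imp_le[OF that] f elim by simp
      hence "{p. prime p \<and> p dvd f} = {p\<in>Q P. p dvd f}"
        by (auto simp: Q_def)
      hence "(\<Prod>p | prime p \<and> p dvd f. inverse (1 + 1 / of_nat p)) =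
          (\<Prod>p\<in>Q P. if p dvd f then inverse (1 + 1 / of_nat p) else (1 :: complex))"
        using finQ by (simp add: prod.inter_filter)
      \<comment> \<open>At a prime dividing \<open>f\<close> this is (1 - 1/p^2) / (1 + 1/p) = 1 -
        1/p.\<close>
      moreover have "(1 - 1 / (of_nat p)\<^sup>2) * (if p dvd f then inverse (1 + 1 / of_nat p) else 1) =
          1 - 1 / (of_nat (r p) :: complex)" if "p \<in> Q P" for p
      proof -
        have "(of_nat p :: complex) \<noteq> 0"
          using that by (auto simp: Q_def prime_gt_0_nat)
        moreover have "(1 + of_nat p :: complex) \<noteq> 0" "(of_nat p + 1 :: complex) \<noteq> 0"
          using of_nat_neq_0[of p, where 'a = complex] by (simp_all add: add.commute)
        ultimately show ?thesis by (auto simp: r_def field_simps power2_eq_square)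
      qed
      ultimately show ?case
        unfolding L_def by (simp add: prod.distrib[symmetric] cong: prod.cong)
    qed
    moreover have "(\<lambda>P. A * (of_real (\<Prod>p\<in>Q P. 1 - 1 / (real p)\<^sup>2) *
      (\<Prod>p | prime p \<and> p dvd f. inverse (1 + 1 / of_nat p)))) \<longlonglongrightarrow>
      A * (of_real (6 / pi\<^sup>2) * (\<Prod>p | prime p \<and> p dvd f. inverse (1 + 1 / of_nat p)))"
      unfolding Q_def by (intro tendsto_intros prod_primes_inverse_squares)
    ultimately show ?thesis by (auto dest: Lim_transform_eventually[rotated])
  qed
  show ?thesis
  \<comment> \<open>\<open>P\<close> is fixed first, using the bound uniform in \<open>N\<close>;
    only then does \<open>N\<close> grow.\<close>
  proof (rule tendstoI)
    fix e :: real assume "e > 0"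
    hence e: "e / 3 > 0" by simp
    have "(\<lambda>P. B / real P) \<longlonglongrightarrow> 0" by (rule lim_const_over_n)
    hence "\<forall>\<^sub>F P in sequentially. B / real P < e / 3" using e by (rule order_tendstoD)
    moreover have "\<forall>\<^sub>F P in sequentially. dist (L P) ?L < e / 3"
      using \<open>L \<longlonglongrightarrow> ?L\<close> e by (rule tendstoD)
    ultimately have "\<forall>\<^sub>F P in sequentially. B / real P < e / 3 \<and> dist (L P) ?L < e / 3 \<and> P \<ge> f"
      using eventually_ge_at_top[of f] by eventually_elim auto
    then obtain P where P: "B / real P < e / 3" "dist (L P) ?L < e / 3" "P \<ge> f"
      by (metis (no_types, lifting) eventually_happens' sequentially_bot)
    have "\<forall>\<^sub>F N in sequentially. dist (G P N) (L P) < e / 3" using G e by (rule tendstoD)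
    thus "\<forall>\<^sub>F N in sequentially. dist (?F N) ?L < e"
    proof eventually_elim
      case (elim N)
      have "dist (?F N) (G P N) < e / 3" 
        unfolding dist_norm by (rule le_less_trans[OF FG[OF P(3)] P(1)])
      thus ?case using elim P(2) dist_triangle_third[of "?F N" "G P N" e "L P" ?L] by blast
    qed
  qed
qed

section \<open>Summability over squarefull numbers\<close>

text \<open>Each exponent k \<ge> 2 in the factorization is 2x + 3y with y the parity of k;
  \<open>a\<close> and \<open>b\<close> collect the primes with exponents x and y.\<close>

lemma squarefull_square_times_cube:
  assumes "squarefull f"
  obtains a b where "a > 0" "b > 0" "f = a\<^sup>2 * b ^ 3"
proof -
  have f0: "f > 0" using assms by (simp add: squarefull_def)
  define k where "k p = multiplicity p f" for p
  define x where "x p = (k p - 3 * (k p mod 2)) div 2" for p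
  define y where "y p = k p mod 2" for p
  define a where "a = (\<Prod>p\<in>prime_factors f. p ^ x p)"
  define b where "b = (\<Prod>p\<in>prime_factors f. p ^ y p)"
  have xy: "k p = x p * 2 + y p * 3" if "p \<in> prime_factors f" for p
  proof -
    have "p\<^sup>2 dvd f" using assms that by (auto simp: squarefull_def in_prime_factors_iff)
    hence "k p \<ge> 2"
      unfolding k_def using f0 that by (intro multiplicity_geI) (auto simp: in_prime_factors_iff)
    show ?thesis
    proof (cases "even (k p)")
      \<comment> \<open>An odd exponent that is at least 2 is at least 3, so the natural-number
        subtraction in \<open>x\<close> is exact.\<close>
      case False
      then obtain j where j: "k p = Suc (2 * j)" by (auto elim: oddE)
      then obtain i where "j = Suc i" using \<open>k p \<ge> 2\<close> by (cases j) auto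
      thus ?thesis using j by (simp add: x_def y_def)
    qed (auto elim: evenE simp: x_def y_def)
  qed
  have "p ^ k p = (p ^ x p)\<^sup>2 * (p ^ y p) ^ 3" if "p \<in> prime_factors f" for p
    unfolding xy[OF that] by (simp add: power_add power_mult)
  hence "(\<Prod>p\<in>prime_factors f. p ^ k p) = a\<^sup>2 * b ^ 3"
    by (simp add: a_def b_def prod.distrib prod_power_distrib)
  moreover have "(\<Prod>p\<in>prime_factors f. p ^ k p) = f"
    unfolding k_def using f0 by (simp add: prime_factorization_nat[symmetric])
  ultimately have "f = a\<^sup>2 * b ^ 3" by (rule trans[OF sym, rotated])
  moreover from this f0 have "a > 0" "b > 0" by (auto intro!: Nat.gr0I)
  ultimately show ?thesis using that by blast
qed

text \<open>Through f = a^2 b^3 the series embeds in the double series of a^(-2s) b^(-3s), which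
  converges because 2s and 3s both exceed 1.\<close>

lemma summable_on_squarefull:
  assumes "s > 1 / 2"
  shows "(\<lambda>f. real f powr - s) summable_on {f. squarefull f}"
proof -
  have "\<exists>x. fst x > 0 \<and> snd x > 0 \<and> f = (fst x)\<^sup>2 * snd x ^ 3" if f: "squarefull f" for f
  proof -
    obtain a b where "a > 0" "b > 0" "f = a\<^sup>2 * b ^ 3" by (rule squarefull_square_times_cube[OF f])
    thus ?thesis by (intro exI[of _ "(a, b)"]) auto
  qed
  \<comment> \<open>\<open>g\<close> chooses one pair for each \<open>f\<close>; it is injective
    since the pair determines \<open>f\<close>.\<close>
  then obtain g where g: "\<And>f. squarefull f \<Longrightarrow> fst (g f) > 0 \<and> snd (g f) > 0 \<and>
      f = (fst (g f))\<^sup>2 * snd (g f) ^ 3"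
    by meson
  \<comment> \<open>The term at 0 is 0, because \<open>0 powr - r = 0\<close>.\<close>
  have sm: "(\<lambda>n. real n powr - r) summable_on UNIV" if "r > 1" for r
    by (rule norm_summable_imp_summable_on) (use that summable_real_powr_iff[of "-r"] in auto)
  have "(\<lambda>(a, b). real a powr - (2 * s) * real b powr - (3 * s)) summable_on UNIV \<times> UNIV"
  proof (rule summable_on_SigmaI)
    show "((\<lambda>b. case (a, b) of (a, b) \<Rightarrow> real a powr - (2 * s) * real b powr - (3 * s)) has_sum
        real a powr - (2 * s) * (\<Sum>\<^sub>\<infinity>b. real b powr - (3 * s))) UNIV" for a
      using assms by (auto intro!: has_sum_cmult_right has_sum_infsum sm)
    show "(\<lambda>a. real a powr - (2 * s) * (\<Sum>\<^sub>\<infinity>b. real b powr - (3 * s))) summable_on UNIV"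
      using assms by (intro summable_on_cmult_left sm) auto
  qed auto
  hence "(\<lambda>(a, b). real a powr - (2 * s) * real b powr - (3 * s)) summable_on (g ` {f. squarefull f})"
    by (rule summable_on_subset_banach) auto
  moreover have "inj_on g {f. squarefull f}"
    using g by (intro inj_onI) (metis mem_Collect_eq)
  ultimately have "((\<lambda>(a, b). real a powr - (2 * s) * real b powr - (3 * s)) \<circ> g) summable_on {f. squarefull f}"
    using summable_on_reindex by blast
  also have "?this \<longleftrightarrow> ?thesis"
  proof (rule summable_on_cong)
    fix f assume "f \<in> {f. squarefull f}"
    hence ab: "fst (g f) > 0" "snd (g f) > 0" "f = (fst (g f))\<^sup>2 * snd (g f) ^ 3" using g by auto
    have "real f = real (fst (g f)) powr 2 * real (snd (g f)) powr 3"
      by (subst ab(3)) (use ab(1,2) in \<open>simp add: powr_numeral\<close>)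
    hence "real f powr - s = real (fst (g f)) powr (2 * - s) * real (snd (g f)) powr (3 * - s)"
      by (simp only: powr_mult powr_ge_zero powr_powr)
    thus "((\<lambda>(a, b). real a powr - (2 * s) * real b powr - (3 * s)) \<circ> g) f = real f powr - s"
      by (simp add: case_prod_unfold)
  qed
  finally show ?thesis .
qed

section \<open>Splitting a sum by the squarefull part\<close>

lemma squarefull_part_mult:
  assumes "squarefull f" "squarefree q" "coprime q f"
  shows "squarefull_part (f * q) = f"
proof -
  have "q > 0" using assms(2) by (cases "q = 0") auto
  moreover have "f > 0" using assms(1) by (simp add: squarefull_def)
  ultimately have "\<exists>!f'. squarefull f' \<and> (\<exists>q'. squarefree q' \<and> coprime q' f' \<and> f * q = q' * f')"
    by (intro squarefull_part_ex1) simp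
  thus ?thesis
    unfolding squarefull_part_def
    by (rule the1_equality) (use assms mult.commute in blast)
qed

lemma squarefull_part_decomp:
  assumes "n > 0"
  shows "\<exists>q. squarefull (squarefull_part n) \<and> squarefree q \<and> coprime q (squarefull_part n) \<and>
           n = squarefull_part n * q"
proof -
  obtain q where "squarefull (squarefull_part n)" "squarefree q" "coprime q (squarefull_part n)"
      "n = q * squarefull_part n"
    using theI'[OF squarefull_part_ex1[OF assms]] unfolding squarefull_part_def[symmetric] by blast
  thus ?thesis using mult.commute by metis
qed

text \<open>The decomposition n = f q is a bijection between the integers up to \<open>N\<close> and
  the admissible pairs with f q \<le> N, and \<open>b\<close> depends on \<open>f\<close>
  alone.\<close>

lemma sum_by_squarefull_part:
  fixes b c :: "nat \<Rightarrow> complex"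
  assumes "\<And>n. n \<ge> 1 \<Longrightarrow> b n = b (squarefull_part n)"
  shows "(\<Sum>n=1..N. b n * c n) =
    (\<Sum>f | f \<in> {1..N} \<and> squarefull f. b f *
       (\<Sum>q | q \<in> {1..N div f} \<and> squarefree q \<and> coprime q f. c (f * q)))"
proof -
  define Q where "Q f = {q. q \<in> {1..N div f} \<and> squarefree q \<and> coprime q f}" for f
  define F where "F = {f. f \<in> {1..N} \<and> squarefull f}"
  have "(\<Sum>f\<in>F. b f * (\<Sum>q\<in>Q f. c (f * q))) = (\<Sum>(f, q)\<in>Sigma F Q. b f * c (f * q))"
    unfolding sum_distrib_left by (rule sum.Sigma) (auto simp: F_def Q_def)
  also have "\<dots> = (\<Sum>n=1..N. b n * c n)"
  proof (rule sum.reindex_bij_witness[of _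
      "\<lambda>n. (squarefull_part n, n div squarefull_part n)" "\<lambda>(f, q). f * q"])
    fix x assume "x \<in> Sigma F Q"
    then obtain f q where x: "x = (f, q)" "f \<in> {1..N}" "squarefull f"
        "q \<in> {1..N div f}" "squarefree q" "coprime q f"
      by (auto simp: F_def Q_def)
    have *: "squarefull_part (f * q) = f" using x by (intro squarefull_part_mult)
    have N: "f * q \<in> {1..N}"
      using x by (auto simp: less_eq_div_iff_mult_less_eq mult.commute Suc_le_eq)
    show "(squarefull_part (case x of (f, q) \<Rightarrow> f * q),
        (case x of (f, q) \<Rightarrow> f * q) div squarefull_part (case x of (f, q) \<Rightarrow> f * q)) = x"
      using x * by simp
    show "(case x of (f, q) \<Rightarrow> f * q) \<in> {1..N}" using x N by simp
    show "b (case x of (f, q) \<Rightarrow> f * q) * c (case x of (f, q) \<Rightarrow> f * q) =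
      (case x of (f, q) \<Rightarrow> b f * c (f * q))"
      using x N * assms[of "f * q"] by simp
  next
    fix n assume n: "n \<in> {1..N}"
    then obtain q where q: "squarefull (squarefull_part n)" "squarefree q"
        "coprime q (squarefull_part n)" "n = squarefull_part n * q"
      using squarefull_part_decomp[of n] by auto
    define f where "f = squarefull_part n"
    have f: "squarefull f" "coprime q f" "n = f * q" using q by (auto simp: f_def)
    have "f > 0" "q > 0" using f(3) n by (auto intro!: Nat.gr0I)
    moreover have "f \<le> n" using f(3) \<open>q > 0\<close> by simp
    hence "f \<le> N" using n by simp
    ultimately show "(squarefull_part n, n div squarefull_part n) \<in> Sigma F Q"
      unfolding f_def[symmetric] using f n q(2)
      by (auto simp: F_def Q_def less_eq_div_iff_mult_less_eq mult.commute Suc_le_eq)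
    show "(case (squarefull_part n, n div squarefull_part n) of (f, q) \<Rightarrow> f * q) = n"
      unfolding f_def[symmetric] using f(3) \<open>f > 0\<close> by simp
  qed
  finally show ?thesis unfolding F_def Q_def ..
qed

section \<open>Termwise limits and the value of the mean\<close>

text \<open>For squarefull \<open>f\<close> this is the natural density of the integers whose
  squarefull part is \<open>f\<close>.\<close>

definition squarefull_density :: "nat \<Rightarrow> complex" where
  "squarefull_density f =
     6 / (of_real pi)\<^sup>2 * (\<Prod>p | prime p \<and> p dvd f. inverse (1 + 1 / of_nat p)) / of_nat f"

text \<open>Dominated convergence for the series over \<open>f\<close> (Tannery's theorem). At most
  N/f values of q occur, so the term of \<open>f\<close> is bounded by |b(f)| B / f, hence by
  \<open>C * B * f powr - (3 / 4)\<close>, which is summable over squarefull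
  \<open>f\<close>.\<close>

lemma average_s_function:
  assumes b: "s_function b" and bnd: "\<And>n. n \<ge> 1 \<Longrightarrow> norm (c n) \<le> B" and inv: "invariant_average c A"
  defines "h \<equiv> \<lambda>f. A * (if squarefull f then b f * squarefull_density f else 0)"
  shows "summable (\<lambda>f. norm (h f))"
    and "(\<lambda>N. (\<Sum>n=1..N. b n * c n) / of_nat N) \<longlonglongrightarrow> suminf h"
proof -
  \<comment> \<open>With exponent 1/4, division by \<open>f\<close> leaves f^(-3/4), and 3/4 > 1/2
    as summability over squarefull numbers requires.\<close>
  obtain C where C: "\<And>n. n \<ge> 1 \<Longrightarrow> norm (b n) \<le> C * real n powr (1 / 4)"
    using b unfolding s_function_def by (metis zero_less_divide_1_iff zero_less_numeral)
  have C0: "C \<ge> 0" using C[of 1] order_trans[OF norm_ge_zero] by fastforce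
  have B0: "B \<ge> 0" using bnd[of 1] order_trans[OF norm_ge_zero] by blast
  define S where "S f N = (\<Sum>q | q \<in> {1..N} \<and> squarefree q \<and> coprime q f. c (f * q))" for f N
  define a where "a f N = (if squarefull f then b f * (S f (N div f) / of_nat N) else 0)" for f N
  define M where "M f = (if squarefull f then C * B * real f powr - (3 / 4) else 0)" for f
  have "summable M"
  proof -
    have "(\<lambda>f. C * B * real f powr - (3 / 4)) summable_on {f. squarefull f}"
      by (intro summable_on_cmult_right summable_on_squarefull) simp
    also have "?this \<longleftrightarrow> M summable_on UNIV"
      by (rule summable_on_cong_neutral) (auto simp: M_def)
    finally show ?thesis by (rule summable_on_imp_summable)
  qed
  have lim: "a f \<longlonglongrightarrow> h f" for f
  proof (cases "squarefull f")
    case True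
    hence "f \<ge> 1" by (simp add: squarefull_def)
    from tendsto_average_div[OF average_squarefree_coprime[OF inv bnd this], of f]
    have "(\<lambda>N. S f (N div f) / of_nat N) \<longlonglongrightarrow> A * squarefull_density f"
      using \<open>f \<ge> 1\<close> by (simp add: S_def squarefull_density_def)
    from tendsto_mult[OF tendsto_const[of "b f"] this] show ?thesis
      using True by (simp add: a_def[abs_def] h_def mult_ac)
  qed (simp add: a_def[abs_def] h_def)
  have bound: "norm (a f N) \<le> M f" for f N
  proof (cases "squarefull f")
    case True
    hence f: "f \<ge> 1" by (simp add: squarefull_def)
    have "norm (S f (N div f)) \<le> real (card {q. q \<in> {1..N div f} \<and> squarefree q \<and> coprime q f}) * B"
      unfolding S_def by (rule sum_norm_bound) (use f in \<open>auto intro!: bnd\<close>)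
    also have "card {q. q \<in> {1..N div f} \<and> squarefree q \<and> coprime q f} \<le> card {1..N div f}"
      by (rule card_mono) auto
    also have "real (card {1..N div f}) \<le> real N / real f"
      using of_nat_div_le_of_nat[of N f, where 'a = real] by simp
    finally have "norm (S f (N div f)) \<le> real N / real f * B"
      using B0 by (simp add: mult_right_mono)
    \<comment> \<open>At \<open>N = 0\<close> the left side is 0 by the convention for
      division.\<close>
    hence "norm (S f (N div f)) / real N \<le> B / real f"
      using B0 by (cases "N = 0") (auto simp: field_simps)
    with C[OF f] have "norm (b f) * (norm (S f (N div f)) / real N) \<le>
        (C * real f powr (1 / 4)) * (B / real f)"
      using C0 by (intro mult_mono) auto
    also have "\<dots> = C * B * (real f powr (1 / 4) / real f powr 1)" using f by simp
    also have "real f powr (1 / 4) / real f powr 1 = real f powr - (3 / 4)"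
      using powr_diff[of "real f" "1 / 4" 1] by simp
    finally show ?thesis using True by (simp add: a_def M_def norm_mult norm_divide)
  qed (simp add: a_def M_def)
  have "eventually (\<lambda>n. summable (\<lambda>k. norm (a k n))) sequentially \<and>
           summable (\<lambda>n. norm (h n)) \<and>
           ((\<lambda>n. suminf (\<lambda>k. a k n)) \<longlongrightarrow> suminf h) sequentially"
    by (rule tannerys_theorem[OF lim _ \<open>summable M\<close>]) (simp_all add: case_prod_unfold bound)
  moreover have "(\<Sum>f. a f N) = (\<Sum>n=1..N. b n * c n) / of_nat N" for N
  proof -
    have "(\<Sum>f. a f N) = (\<Sum>f | f \<in> {1..N} \<and> squarefull f. a f N)"
    proof (rule suminf_finite)
      fix f assume f: "f \<notin> {f. f \<in> {1..N} \<and> squarefull f}"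
      show "a f N = 0"
      proof (cases "squarefull f")
        case True
        \<comment> \<open>A squarefull \<open>f\<close> outside the range exceeds \<open>N\<close>,
          so its inner sum is empty and the series is finite.\<close>
        hence "N div f = 0" using f by (auto simp: squarefull_def div_eq_0_iff)
        hence "S f (N div f) = 0" by (simp add: S_def)
        thus ?thesis by (simp add: a_def)
      qed (simp add: a_def)
    qed simp
    also have "\<dots> = (\<Sum>f | f \<in> {1..N} \<and> squarefull f. b f * S f (N div f)) / of_nat N"
      unfolding sum_divide_distrib by (rule sum.cong) (auto simp: a_def)
    also have "\<dots> = (\<Sum>n=1..N. b n * c n) / of_nat N"
      using b unfolding S_def by (subst sum_by_squarefull_part) (auto simp: s_function_def)
    finally show ?thesis .
  qed
  ultimately show "summable (\<lambda>f. norm (h f))"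
    and "(\<lambda>N. (\<Sum>n=1..N. b n * c n) / of_nat N) \<longlonglongrightarrow> suminf h" by auto
qed

text \<open>With the constant 1 in the role of \<open>c\<close>, the general limit becomes the mean
  of \<open>b\<close> itself.\<close>

lemma invariant_average_const: "invariant_average (\<lambda>_. A) A"
proof -
  have "(\<lambda>N. (\<Sum>n=1..N. A) / of_nat N) \<longlonglongrightarrow> A"
    by (rule Lim_transform_eventually[OF tendsto_const])
       (use eventually_gt_at_top[of 0] in eventually_elim, simp)
  thus ?thesis by (simp add: invariant_average_def)
qed

theorem theorem1p1:
  fixes b c :: "nat \<Rightarrow> complex" and A :: complex
  assumes "s_function b"
    and "bounded (c ` {1..})"
    and "invariant_average c A"
  shows "\<exists>\<alpha>.
    (\<lambda>N. (\<Sum>n=1..N. b n * c n) / of_nat N) \<longlonglongrightarrow> \<alpha> * A \<and>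
    (\<lambda>N. (\<Sum>n=1..N. b n) / of_nat N) \<longlonglongrightarrow> \<alpha> \<and>
    (\<lambda>f. b f / of_nat f * (\<Prod>p | prime p \<and> p dvd f. inverse (1 + 1 / of_nat p)))
      summable_on {f. squarefull f} \<and>
    \<alpha> = 6 / (of_real pi)\<^sup>2 *
      (\<Sum>\<^sub>\<infinity>f | squarefull f.
        b f / of_nat f * (\<Prod>p | prime p \<and> p dvd f. inverse (1 + 1 / of_nat p)))"
proof -
  define w where "w f = b f / of_nat f * (\<Prod>p | prime p \<and> p dvd f. inverse (1 + 1 / of_nat p))" for f
  define h where "h f = (if squarefull f then b f * squarefull_density f else 0)" for f
  obtain B where B: "\<And>n. n \<ge> 1 \<Longrightarrow> norm (c n) \<le> B"
    using assms(2) unfolding bounded_iff by auto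
  \<comment> \<open>The case \<open>c = 1\<close>, \<open>A = 1\<close> shows that
    \<open>suminf h\<close> is the constant \<alpha>.\<close>
  have h: "summable (\<lambda>f. norm (h f))" "(\<lambda>N. (\<Sum>n=1..N. b n) / of_nat N) \<longlonglongrightarrow> suminf h"
    using average_s_function[OF assms(1) _ invariant_average_const[of 1], of 1]
    by (simp_all add: h_def[abs_def])
  have "(\<lambda>N. (\<Sum>n=1..N. b n * c n) / of_nat N) \<longlonglongrightarrow> (\<Sum>f. A * h f)"
    unfolding h_def by (rule average_s_function(2)[OF assms(1) B assms(3)])
  also have "(\<Sum>f. A * h f) = suminf h * A"
    using suminf_mult[OF summable_norm_cancel[OF h(1)], of A] by (simp add: mult.commute)
  finally have bc: "(\<lambda>N. (\<Sum>n=1..N. b n * c n) / of_nat N) \<longlonglongrightarrow> suminf h * A" .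
  have hw: "h f = 6 / (of_real pi)\<^sup>2 * w f" if "squarefull f" for f
    using that by (simp add: h_def w_def squarefull_density_def)
  \<comment> \<open>Absolute convergence turns the ordered series into an unordered sum, and the
    terms that are not squarefull vanish.\<close>
  have "(h has_sum suminf h) UNIV"
    by (rule norm_summable_imp_has_sum[OF h(1) summable_sums[OF summable_norm_cancel[OF h(1)]]])
  also have "?this \<longleftrightarrow> ((\<lambda>f. 6 / (of_real pi)\<^sup>2 * w f) has_sum suminf h) {f. squarefull f}"
    by (rule has_sum_cong_neutral) (simp_all add: hw, simp add: h_def)
  finally have s: "((\<lambda>f. 6 / (of_real pi)\<^sup>2 * w f) has_sum suminf h) {f. squarefull f}" .
  have "w summable_on {f. squarefull f}"
    using has_sum_imp_summable[OF s] by (subst (asm) summable_on_cmult_right') auto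
  moreover have "suminf h = 6 / (of_real pi)\<^sup>2 * infsum w {f. squarefull f}"
    using infsumI[OF s] unfolding infsum_cmult_right' by (rule sym)
  ultimately show ?thesis using bc h(2) unfolding w_def by blast
qed

end
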